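(* Let $I=\{1,\ldots,p\}$ and let $f_{i}:\mathbb{R}^n\to \mathbb{R}$ be directed subdifferentiable at $x\in \mathbb{R}^n$ for every $i \in I$. Then the pointwise minimum function $f:\mathbb{R}^n\to \mathbb{R}$, $f(\cdot) = \min_{i \in I} f_i(\cdot)$, is also directed subdifferentiable at $x$. Moreover, $$\overrightarrow{\partial} f(x) = \inf_{i\in I(x)}\{\overrightarrow{\partial} f_i(x)\},$$ where $I(x) = \{ i \in I\,|\, f(x) = f_i(x) \}$ is the set of active indices.
   Context: Notation. $\mathcal{S}_{n-1}$ is the Euclidean unit sphere in $\mathbb{R}^n$ (so $\mathcal{S}_0=\{-1,1\}$). The (Dini) directional derivative of $f:\mathbb{R}^n\to\mathbb{R}$ at $x$ in direction $l$ is $f'(x;l)=\lim_{t\downarrow 0}\frac{f(x+tl)-f(x)}{t}$. For $n\ge 2$ and $l\in\mathcal{S}_{n-1}$, $\Pi_{n-1,l}:\mathbb{R}^n\to\mathbb{R}^{n-1}$ is a fixed linear map that maps the orthogonal complement of $l$ isometrically onto $\mathbb{R}^{n-1}$ and maps $l$ to $0$; its transpose $\Pi_{n-1,l}^\top:\mathbb{R}^{n-1}\to\mathbb{R}^n$ maps $\mathbb{R}^{n-1}$ onto the orthogonal complement of $l$ and inverts the restriction of $\Pi_{n-1,l}$ to that complement. Directed subdifferentiable functions. A function $f:\mathbb{R}\to\mathbb{R}$ is $M$-directed subdifferentiable at $x\in\mathbb{R}$ if $f'(x;1)$ and $f'(x;-1)$ exist and $\max\{|f'(x;-1)|,|f'(x;1)|\}\le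 M$. A function $f:\mathbb{R}^n\to\mathbb{R}$, $n\ge2$, is $M$-directed subdifferentiable at $x\in\mathbb{R}^n$ if $f'(x;l)$ exists for every $l$, is continuous as a function of $l$, satisfies $\max_{l\in\mathcal{S}_{n-1}}|f'(x;l)|\le M$, and for every $l\in\mathcal{S}_{n-1}$ the function $f_l:\mathbb{R}^{n-1}\to\mathbb{R}$, $f_l(\cdot)=f'(x;l+\Pi_{n-1,l}^\top(\cdot))$, is $M$-directed subdifferentiable at $0_{n-1}$. $f$ is directed subdifferentiable at $x$ if it is $M$-directed subdifferentiable at $x$ for some $M\ge 0$. Directed sets. For $n=1$ a directed set is a directed interval $\overrightarrow{[a,b]}$ with $a,b\in\mathbb{R}$ arbitrary, identified with the pair $(a_1(-1),a_1(1))=(-a,b)$; its norm is $\max\{|a_1(-1)|,|a_1(1)|\}$. For $n\ge2$ a directed set is a family $\overrightarrow{A}=(\overrightarrow{A_{n-1}(l)},a_n(l))_{l\in\mathcal{S}_{n-1}}$ with $a_n:\mathcal{S}_{n-1}\to\mathbb{R}$ continuous and $l\mapsto\overrightarrow{A_{n-1}(l)}$ a map into $(n-1)$-dimensional directed sets, uniformly bounded in norm; its norm is $\max\{\sup_l\|\overrightarrow{A_{n-1}(l)}\|,\max_l|a_n(l)|\}$. Infimum of finitely many directed sets (finite nonempty index set $I$). For $n=1$ and $\overrightarrow{A_i}=\overrightarrow{[\alpha_i^-,\alpha_i^+]}$: $\inf_{i\in I}\{\overrightarrow{A_i}\}=\overrightarrow{[\max_{i\in I}\alpha_i^-,\min_{i\in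 I}\alpha_i^+]}$. For $n\ge2$ and $\overrightarrow{A^i_n}=(\overrightarrow{A^i_{n-1}(l)},a^i_n(l))_{l\in\mathcal{S}_{n-1}}$: $\inf_{i\in I}\{\overrightarrow{A^i_n}\}=\big(\inf_{i\in J(l)}\{\overrightarrow{A^i_{n-1}(l)}\},\min_{i\in I}a^i_n(l)\big)_{l\in\mathcal{S}_{n-1}}$, where $J(l)=\{i\in I\,|\,a^i_n(l)=\min_{k\in I}a^k_n(l)\}$. Directed subdifferential. For $f$ directed subdifferentiable at $x$: if $n=1$, $\overrightarrow{\partial} f(x)=\overrightarrow{[-f'(x;-1),f'(x;1)]}=(f'(x;l))_{l=\pm1}$; if $n\ge2$, $\overrightarrow{\partial} f(x)=(\overrightarrow{\partial} f_l(0),f'(x;l))_{l\in\mathcal{S}_{n-1}}$ with $f_l(\cdot)=f'(x;l+\Pi_{n-1,l}^\top(\cdot))$. *)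

theory Defs
  imports "HOL-Analysis.Analysis"
begin

text \<open>
  The notions below recurse on the dimension, so \<open>\<real>\<^sup>n\<close> is the library's
  \<^term>\<open>Euclidean_space n\<close>: vectors are functions \<^typ>\<open>nat \<Rightarrow> real\<close> vanishing on
  all indices \<open>\<ge> n\<close>. The unit sphere of \<open>\<real>\<^sup>n\<close> is \<^term>\<open>nsphere (n - 1)\<close>. A function on \<open>\<real>\<^sup>n\<close>
  is a total function on \<^typ>\<open>nat \<Rightarrow> real\<close> of which only the values on \<open>\<real>\<^sup>n\<close> matter.
\<close>

type_synonym vec = "nat \<Rightarrow> real"

abbreviation Rn :: "nat \<Rightarrow> vec set" where
  "Rn n \<equiv> topspace (Euclidean_space n)"

abbreviation unit_sphere :: "nat \<Rightarrow> vec set" where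
  "unit_sphere n \<equiv> topspace (nsphere (n - 1))"

definition line_vec :: "real \<Rightarrow> vec" where
  "line_vec s = (\<lambda>i. if i = 0 then s else 0)"


section \<open>Directional derivatives\<close>

definition has_dir_deriv :: "(vec \<Rightarrow> real) \<Rightarrow> vec \<Rightarrow> vec \<Rightarrow> real \<Rightarrow> bool" where
  "has_dir_deriv f x l d \<longleftrightarrow>
     ((\<lambda>t. (f (\<lambda>i. x i + t * l i) - f x) / t) \<longlongrightarrow> d) (at_right 0)"

definition dir_differentiable :: "(vec \<Rightarrow> real) \<Rightarrow> vec \<Rightarrow> vec \<Rightarrow> bool" where
  "dir_differentiable f x l \<longleftrightarrow> (\<exists>d. has_dir_deriv f x l d)"

definition dir_deriv :: "(vec \<Rightarrow> real) \<Rightarrow> vec \<Rightarrow> vec \<Rightarrow> real" where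
  "dir_deriv f x l = Lim (at_right 0) (\<lambda>t. (f (\<lambda>i. x i + t * l i) - f x) / t)"


section \<open>The projections along a direction\<close>

definition orth_compl :: "nat \<Rightarrow> vec \<Rightarrow> vec set" where
  "orth_compl n l = {y \<in> Rn n. (\<Sum>i<n. y i * l i) = 0}"

definition is_projection :: "nat \<Rightarrow> vec \<Rightarrow> (vec \<Rightarrow> vec) \<Rightarrow> bool" where
  "is_projection n l P \<longleftrightarrow>
     P ` Rn n \<subseteq> Rn (n - 1) \<and>
     (\<forall>y\<in>Rn n. \<forall>z\<in>Rn n. P (\<lambda>i. y i + z i) = (\<lambda>i. P y i + P z i)) \<and>
     (\<forall>c. \<forall>y\<in>Rn n. P (\<lambda>i. c * y i) = (\<lambda>i. c * P y i)) \<and>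
     P l = (\<lambda>i. 0) \<and>
     P ` orth_compl n l = Rn (n - 1) \<and>
     (\<forall>y\<in>orth_compl n l. \<forall>z\<in>orth_compl n l.
        L2_set (\<lambda>i. P y i - P z i) {..<n - 1} = L2_set (\<lambda>i. y i - z i) {..<n})"

text \<open>The transpose of a linear map from \<open>\<real>\<^sup>n\<close> to \<open>\<real>\<^bsup>n-1\<^esup>\<close>; the entry of its matrix in row \<open>i\<close>
  and column \<open>j\<close> is \<open>P e\<^sub>j i\<close>.\<close>

definition transpose_map :: "nat \<Rightarrow> (vec \<Rightarrow> vec) \<Rightarrow> vec \<Rightarrow> vec" where
  "transpose_map n P y =
     (\<lambda>j. if j < n then \<Sum>i<n - 1. P (\<lambda>k. if k = j then 1 else 0) i * y i else 0)"

text \<open>The function \<open>f\<^sub>l\<close> on \<open>\<real>\<^bsup>n-1\<^esup>\<close>. The parameter \<open>Pr\<close> is the fixed family of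
  projections, with \<open>Pr n l\<close> the one from \<open>\<real>\<^sup>n\<close> to \<open>\<real>\<^bsup>n-1\<^esup>\<close> along \<open>l\<close>.\<close>

definition slice ::
  "(nat \<Rightarrow> vec \<Rightarrow> vec \<Rightarrow> vec) \<Rightarrow> nat \<Rightarrow> (vec \<Rightarrow> real) \<Rightarrow> vec \<Rightarrow> vec \<Rightarrow> vec \<Rightarrow> real" where
  "slice Pr n f x l y = dir_deriv f x (\<lambda>i. l i + transpose_map n (Pr n l) y i)"


section \<open>Directed subdifferentiable functions\<close>

text \<open>Dimension 0 does not occur; it is left unspecified here and in the recursions below.\<close>

fun M_directed_subdifferentiable ::
  "(nat \<Rightarrow> vec \<Rightarrow> vec \<Rightarrow> vec) \<Rightarrow> real \<Rightarrow> nat \<Rightarrow> (vec \<Rightarrow> real) \<Rightarrow> vec \<Rightarrow> bool" where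
  "M_directed_subdifferentiable Pr M (Suc 0) f x \<longleftrightarrow>
     dir_differentiable f x (line_vec 1) \<and> dir_differentiable f x (line_vec (-1)) \<and>
     max \<bar>dir_deriv f x (line_vec (-1))\<bar> \<bar>dir_deriv f x (line_vec 1)\<bar> \<le> M"
| "M_directed_subdifferentiable Pr M (Suc (Suc n)) f x \<longleftrightarrow>
     (\<forall>l\<in>Rn (Suc (Suc n)). dir_differentiable f x l) \<and>
     continuous_map (Euclidean_space (Suc (Suc n))) euclideanreal (dir_deriv f x) \<and>
     (\<forall>l\<in>unit_sphere (Suc (Suc n)). \<bar>dir_deriv f x l\<bar> \<le> M) \<and>
     (\<forall>l\<in>unit_sphere (Suc (Suc n)).
        M_directed_subdifferentiable Pr M (Suc n) (slice Pr (Suc (Suc n)) f x l) (\<lambda>i. 0))"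

definition directed_subdifferentiable ::
  "(nat \<Rightarrow> vec \<Rightarrow> vec \<Rightarrow> vec) \<Rightarrow> nat \<Rightarrow> (vec \<Rightarrow> real) \<Rightarrow> vec \<Rightarrow> bool" where
  "directed_subdifferentiable Pr n f x \<longleftrightarrow> (\<exists>M\<ge>0. M_directed_subdifferentiable Pr M n f x)"


section \<open>Directed sets\<close>

text \<open>One type holds the directed sets of all dimensions; the predicate \<open>directed_set n\<close>
  below selects those of dimension \<open>n\<close>. \<open>Directed_Interval a b\<close> is the directed interval
  with arbitrary end points \<open>a\<close>, \<open>b\<close>, i.e. the pair \<open>(a\<^sub>1(-1), a\<^sub>1(1)) = (-a, b)\<close>.
  \<open>Directed_Family A a\<close> is the family \<open>(A l, a l)\<close> indexed by the unit sphere. Families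
  are made extensional with \<^const>\<open>restrict\<close>, so that equality in this type is
  equality of families over the sphere.\<close>

datatype directed =
    Directed_Interval (lower: real) (upper: real)
  | Directed_Family (part: "vec \<Rightarrow> directed") (supp: "vec \<Rightarrow> real")

fun directed_norm :: "nat \<Rightarrow> directed \<Rightarrow> real" where
  "directed_norm (Suc 0) A = max \<bar>- lower A\<bar> \<bar>upper A\<bar>"
| "directed_norm (Suc (Suc n)) A =
     max (SUP l\<in>unit_sphere (Suc (Suc n)). directed_norm (Suc n) (part A l))
         (SUP l\<in>unit_sphere (Suc (Suc n)). \<bar>supp A l\<bar>)"

fun directed_set :: "nat \<Rightarrow> directed \<Rightarrow> bool" where
  "directed_set (Suc 0) A \<longleftrightarrow> (\<exists>a b. A = Directed_Interval a b)"
| "directed_set (Suc (Suc n)) A \<longleftrightarrow>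
     (\<exists>B b. A = Directed_Family B b \<and>
        B \<in> extensional (unit_sphere (Suc (Suc n))) \<and>
        b \<in> extensional (unit_sphere (Suc (Suc n))) \<and>
        continuous_map (nsphere (Suc n)) euclideanreal b \<and>
        (\<forall>l\<in>unit_sphere (Suc (Suc n)). directed_set (Suc n) (B l)) \<and>
        bdd_above ((\<lambda>l. directed_norm (Suc n) (B l)) ` unit_sphere (Suc (Suc n))))"

fun directed_Inf :: "nat \<Rightarrow> 'i set \<Rightarrow> ('i \<Rightarrow> directed) \<Rightarrow> directed" where
  "directed_Inf (Suc 0) I A =
     Directed_Interval (MAX i\<in>I. lower (A i)) (MIN i\<in>I. upper (A i))"
| "directed_Inf (Suc (Suc n)) I A =
     Directed_Family
       (\<lambda>l\<in>unit_sphere (Suc (Suc n)).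
          directed_Inf (Suc n) {i \<in> I. supp (A i) l = (MIN k\<in>I. supp (A k) l)}
            (\<lambda>i. part (A i) l))
       (\<lambda>l\<in>unit_sphere (Suc (Suc n)). MIN i\<in>I. supp (A i) l)"


section \<open>The directed subdifferential\<close>

fun directed_subdifferential ::
  "(nat \<Rightarrow> vec \<Rightarrow> vec \<Rightarrow> vec) \<Rightarrow> nat \<Rightarrow> (vec \<Rightarrow> real) \<Rightarrow> vec \<Rightarrow> directed" where
  "directed_subdifferential Pr (Suc 0) f x =
     Directed_Interval (- dir_deriv f x (line_vec (-1))) (dir_deriv f x (line_vec 1))"
| "directed_subdifferential Pr (Suc (Suc n)) f x =
     Directed_Family
       (\<lambda>l\<in>unit_sphere (Suc (Suc n)).
          directed_subdifferential Pr (Suc n) (slice Pr (Suc (Suc n)) f x l) (\<lambda>i. 0))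
       (\<lambda>l\<in>unit_sphere (Suc (Suc n)). dir_deriv f x l)"


section \<open>Well-definedness\<close>

lemma unit_sphere_nonempty: "unit_sphere (Suc n) \<noteq> {}"
  using in_topspace_nsphere[of n] by auto

lemma directed_subdifferential_bounded:
  assumes "M_directed_subdifferentiable Pr M (Suc n) f x"
  shows "directed_set (Suc n) (directed_subdifferential Pr (Suc n) f x) \<and>
         directed_norm (Suc n) (directed_subdifferential Pr (Suc n) f x) \<le> M"
  using assms
proof (induction n arbitrary: f x)
  case 0
  then show ?case by simp
next
  case (Suc n)
  let ?S = "topspace (nsphere (Suc n))"
  let ?D = "\<lambda>l. directed_subdifferential Pr (Suc n) (slice Pr (Suc (Suc n)) f x l) (\<lambda>i. 0)"
  have D: "directed_set (Suc n) (?D l)" "directed_norm (Suc n) (?D l) \<le> M" if "l \<in> ?S" for l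
    using Suc.IH Suc.prems that by auto
  have bd: "\<bar>dir_deriv f x l\<bar> \<le> M" if "l \<in> ?S" for l
    using Suc.prems that by auto
  have "continuous_map (nsphere (Suc n)) euclideanreal (dir_deriv f x)"
    using Suc.prems unfolding nsphere_def by (simp add: continuous_map_from_subtopology)
  then have cont: "continuous_map (nsphere (Suc n)) euclideanreal (\<lambda>l\<in>?S. dir_deriv f x l)"
    by (rule continuous_map_eq) simp
  have "?S \<noteq> {}" using unit_sphere_nonempty[of "Suc n"] by simp
  then have "(SUP l\<in>?S. directed_norm (Suc n) (?D l)) \<le> M" "(SUP l\<in>?S. \<bar>dir_deriv f x l\<bar>) \<le> M"
    using D bd by (auto intro!: cSUP_least)
  moreover have "bdd_above ((\<lambda>l. directed_norm (Suc n) (?D l)) ` ?S)"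
    by (rule bdd_aboveI2) (rule D)
  ultimately show ?case
    using D cont by (simp cong: image_cong_simp)
qed

lemma directed_set_directed_subdifferential:
  assumes "n \<ge> 1" "directed_subdifferentiable Pr n f x"
  shows "directed_set n (directed_subdifferential Pr n f x)"
  using assms directed_subdifferential_bounded[of Pr _ "n - 1" f x]
  by (auto simp: directed_subdifferentiable_def)

lemma continuous_map_Min:
  fixes b :: "'i \<Rightarrow> 'a \<Rightarrow> real"
  assumes "finite I" "I \<noteq> {}" "\<And>i. i \<in> I \<Longrightarrow> continuous_map X euclideanreal (b i)"
  shows "continuous_map X euclideanreal (\<lambda>l. MIN i\<in>I. b i l)"
  using assms by (induction I rule: finite_ne_induct) (auto intro: continuous_map_real_min)

lemma compact_space_nsphere: "compact_space (nsphere n)"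
proof -
  let ?T = "powertop_real (UNIV :: nat set)"
  let ?C = "{x. (\<Sum>i\<le>n. x i ^ 2) = 1 \<and> (\<forall>i>n. x i = (0::real))}"
  have "closed ?C"
    by (intro closed_Collect_conj closed_Collect_all closed_Collect_imp closed_Collect_eq
        continuous_intros open_Collect_const continuous_on_product_coordinates)
  then have "closedin ?T ?C"
    by (simp add: euclidean_product_topology)
  moreover have "compactin ?T (PiE UNIV (\<lambda>i. {-1..1}))"
    by (simp add: compactin_PiE)
  moreover have "?C \<subseteq> PiE UNIV (\<lambda>i. {-1..1})"
  proof (clarsimp simp: PiE_UNIV_domain)
    fix x :: vec and i
    assume x: "(\<Sum>i\<le>n. (x i)\<^sup>2) = 1" "\<forall>i>n. x i = 0"
    have "(x i)\<^sup>2 \<le> 1"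
    proof (cases "i \<le> n")
      case True
      then show ?thesis
        using member_le_sum[of i "{..n}" "\<lambda>i. (x i)\<^sup>2"] x by simp
    qed (use x in auto)
    then show "-1 \<le> x i \<and> x i \<le> 1"
      by (simp add: abs_square_le_1 abs_le_iff)
  qed
  ultimately have "compactin ?T ?C"
    by (blast intro: closed_compactin)
  then show ?thesis
    unfolding nsphere by (rule compact_space_subtopology)
qed

lemma directed_Inf_bounded:
  assumes "finite I" "I \<noteq> {}"
    and "\<And>i. i \<in> I \<Longrightarrow> directed_set (Suc n) (A i)"
    and "\<And>i. i \<in> I \<Longrightarrow> directed_norm (Suc n) (A i) \<le> M"
  shows "directed_set (Suc n) (directed_Inf (Suc n) I A) \<and>
         directed_norm (Suc n) (directed_Inf (Suc n) I A) \<le> M"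
  using assms
proof (induction n arbitrary: I A)
  case 0
  have "(MAX i\<in>I. lower (A i)) \<in> (\<lambda>i. lower (A i)) ` I"
       "(MIN i\<in>I. upper (A i)) \<in> (\<lambda>i. upper (A i)) ` I"
    using 0 by (auto intro!: Max_in Min_in)
  then obtain i j where "i \<in> I" "(MAX i\<in>I. lower (A i)) = lower (A i)"
      "j \<in> I" "(MIN i\<in>I. upper (A i)) = upper (A j)"
    by (auto simp only: image_iff)
  then show ?case using 0(4)[of i] 0(4)[of j] by (simp del: Max_less_iff)
next
  case (Suc n)
  let ?S = "topspace (nsphere (Suc n))"
  let ?J = "\<lambda>l. {i \<in> I. supp (A i) l = (MIN k\<in>I. supp (A k) l)}"
  let ?D = "\<lambda>l. directed_Inf (Suc n) (?J l) (\<lambda>i. part (A i) l)"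
  have ne: "?S \<noteq> {}" using unit_sphere_nonempty[of "Suc n"] by simp
  have cs: "continuous_map (nsphere (Suc n)) euclideanreal (supp (A i))"
    and ds: "l \<in> ?S \<Longrightarrow> directed_set (Suc n) (part (A i) l)"
    and bd: "bdd_above ((\<lambda>l. directed_norm (Suc n) (part (A i) l)) ` ?S)" if "i \<in> I" for i l
    using Suc.prems(3)[OF that] by auto
  have bs: "bdd_above ((\<lambda>l. \<bar>supp (A i) l\<bar>) ` ?S)" if "i \<in> I" for i
  proof -
    have "compactin euclideanreal ((\<lambda>l. \<bar>supp (A i) l\<bar>) ` ?S)"
      using compact_space_nsphere continuous_map_real_abs[OF cs[OF that]]
      unfolding compact_space_def by (rule image_compactin)
    then show ?thesis by (simp add: compact_imp_bounded bounded_imp_bdd_above)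
  qed
  have "(SUP l\<in>?S. directed_norm (Suc n) (part (A i) l)) \<le> M" "(SUP l\<in>?S. \<bar>supp (A i) l\<bar>) \<le> M"
    if "i \<in> I" for i
    using Suc.prems(4)[OF that] by auto
  then have dn: "directed_norm (Suc n) (part (A i) l) \<le> M" and sn: "\<bar>supp (A i) l\<bar> \<le> M"
    if "i \<in> I" "l \<in> ?S" for i l
    using cSUP_upper[OF that(2) bd[OF that(1)]] cSUP_upper[OF that(2) bs[OF that(1)]] that
    by (meson order_trans)+
  have Min: "(MIN k\<in>I. supp (A k) l) \<in> (\<lambda>k. supp (A k) l) ` I" for l
    using Suc.prems by (intro Min_in) auto
  then have J: "?J l \<noteq> {}" "finite (?J l)" for l
    using Suc.prems by (auto simp: image_iff) metis
  have D: "directed_set (Suc n) (?D l)" "directed_norm (Suc n) (?D l) \<le> M" if "l \<in> ?S" for l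
    using Suc.IH[OF J(2,1), of l "\<lambda>i. part (A i) l"] ds dn that by auto
  have m: "\<bar>MIN i\<in>I. supp (A i) l\<bar> \<le> M" if "l \<in> ?S" for l
    using Min[of l] sn that by (metis (no_types, lifting) imageE)
  have "continuous_map (nsphere (Suc n)) euclideanreal (\<lambda>l. MIN i\<in>I. supp (A i) l)"
    using Suc.prems cs by (intro continuous_map_Min) auto
  then have cont: "continuous_map (nsphere (Suc n)) euclideanreal (\<lambda>l\<in>?S. MIN i\<in>I. supp (A i) l)"
    by (rule continuous_map_eq) simp
  have "(SUP l\<in>?S. directed_norm (Suc n) (?D l)) \<le> M" "(SUP l\<in>?S. \<bar>MIN i\<in>I. supp (A i) l\<bar>) \<le> M"
    using D m ne by (auto intro!: cSUP_least)
  moreover have "bdd_above ((\<lambda>l. directed_norm (Suc n) (?D l)) ` ?S)"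
    by (rule bdd_aboveI2) (rule D)
  ultimately show ?case
    using D cont by (simp cong: image_cong_simp)
qed

lemma directed_set_directed_Inf:
  assumes "n \<ge> 1" "finite I" "I \<noteq> {}" "\<And>i. i \<in> I \<Longrightarrow> directed_set n (A i)"
  shows "directed_set n (directed_Inf n I A)"
proof -
  obtain k where n: "n = Suc k" using assms(1) by (cases n) auto
  have "directed_norm n (A i) \<le> (MAX i\<in>I. directed_norm n (A i))" if "i \<in> I" for i
    using assms(2) that by simp
  then show ?thesis
    using directed_Inf_bounded[of I k A] assms unfolding n by blast
qed

end

theory Submission
  imports Defs
begin

text \<open>
  Along a ray from \<open>x\<close> only the active functions matter near \<open>x\<close>, so the directional derivative of
  the minimum is the minimum of the active directional derivatives. Hence the slices of the minimum
  at \<open>x\<close> are again pointwise minima, in one dimension less, of the slices of the active functions,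
  and their active indices at the origin are exactly the set \<open>J(l)\<close> in the definition of the infimum.
\<close>

lemma has_dir_derivD: "has_dir_deriv f x l d \<Longrightarrow> dir_deriv f x l = d"
  unfolding has_dir_deriv_def dir_deriv_def by (intro tendsto_Lim) auto

lemma dir_differentiable_iff: "dir_differentiable f x l \<longleftrightarrow> has_dir_deriv f x l (dir_deriv f x l)"
  unfolding dir_differentiable_def using has_dir_derivD by blast

text \<open>A finite one-sided derivative forces continuity along the ray: the value at parameter
  \<open>t\<close> is \<open>f x\<close> plus \<open>t\<close> times the difference quotient, and
  that product tends to \<open>0 * d\<close>.\<close>

lemma has_dir_deriv_imp_tendsto:
  assumes "has_dir_deriv f x l d"
  shows "((\<lambda>t. f (\<lambda>i. x i + t * l i)) \<longlongrightarrow> f x) (at_right 0)"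
proof -
  have "((\<lambda>t. f x + t * ((f (\<lambda>i. x i + t * l i) - f x) / t)) \<longlongrightarrow> f x + 0 * d) (at_right 0)"
    using assms unfolding has_dir_deriv_def by (intro tendsto_intros) auto
  moreover have "eventually (\<lambda>t. f x + t * ((f (\<lambda>i. x i + t * l i) - f x) / t)
      = f (\<lambda>i. x i + t * l i)) (at_right (0::real))"
    using eventually_at_right_less[of "0::real"] by eventually_elim simp
  ultimately show ?thesis
    using tendsto_cong by force
qed

lemma tendsto_Min:
  fixes q :: "'i \<Rightarrow> 'a \<Rightarrow> real"
  assumes "finite I" "I \<noteq> {}" "\<And>i. i \<in> I \<Longrightarrow> (q i \<longlongrightarrow> d i) F"
  shows "((\<lambda>t. MIN i\<in>I. q i t) \<longlongrightarrow> (MIN i\<in>I. d i)) F"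
  using assms by (induction I rule: finite_ne_induct) (auto intro: tendsto_min)

lemma Min_image_in: "finite I \<Longrightarrow> I \<noteq> {} \<Longrightarrow> \<exists>i\<in>I. (MIN i\<in>I. h i) = h i"
  using Min_in[of "h ` I"] by (simp add: image_iff)

lemma active_nonempty:
  assumes "finite I" "I \<noteq> {}" "g x = (MIN i\<in>I. f i x)"
  shows "{i \<in> I. g x = f i x} \<noteq> {}"
  using Min_image_in[OF assms(1,2), of "\<lambda>i. f i x"] assms(3) by auto

text \<open>All active functions share the value \<open>g x\<close> at \<open>x\<close>, so
  subtracting it and dividing by \<open>t > 0\<close> commutes with taking their minimum. The
  inactive ones start with a positive gap above, which survives for small \<open>t\<close>.\<close>

lemma has_dir_deriv_Min:
  assumes I: "finite I" "I \<noteq> {}"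
    and ray: "\<And>t. t \<ge> 0 \<Longrightarrow>
      g (\<lambda>k. x k + t * l k) = (MIN i\<in>I. f i (\<lambda>k. x k + t * l k))"
    and d: "\<And>i. i \<in> I \<Longrightarrow> has_dir_deriv (f i) x l (d i)"
  shows "has_dir_deriv g x l (MIN i\<in>{i \<in> I. g x = f i x}. d i)"
proof -
  define J where "J = {i \<in> I. g x = f i x}"
  let ?y = "\<lambda>t k. x k + t * l k"
  have gx: "g x = (MIN i\<in>I. f i x)" using ray[of 0] by simp
  have J: "finite J" "J \<noteq> {}" "J \<subseteq> I"
    using I active_nonempty[of I g x f] gx by (auto simp: J_def)
  then obtain j where j: "j \<in> J" by blast
  \<comment> \<open>A single active \<open>j\<close> serves as the reference for every inactive
    \<open>i\<close>; finiteness of \<open>I\<close> merges the individual neighbourhoods into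
    one.\<close>
  have "eventually (\<lambda>t. \<forall>i\<in>I - J. f j (?y t) < f i (?y t)) (at_right 0)"
  proof (intro eventually_ball_finite ballI)
    fix i assume i: "i \<in> I - J"
    then have "f j x < f i x"
      using gx j I Min_le[of "(\<lambda>i. f i x) ` I" "f i x"] by (force simp: J_def)
    moreover have "((\<lambda>t. f i (?y t) - f j (?y t)) \<longlongrightarrow> f i x - f j x) (at_right 0)"
      using i j J by (intro tendsto_diff has_dir_deriv_imp_tendsto[OF d]) auto
    ultimately have "eventually (\<lambda>t. 0 < f i (?y t) - f j (?y t)) (at_right 0)"
      by (intro order_tendstoD(1)) auto
    then show "eventually (\<lambda>t. f j (?y t) < f i (?y t)) (at_right 0)"
      by simp
  qed (use I in auto)
  then have "eventually (\<lambda>t. (MIN i\<in>J. (f i (?y t) - f i x) / t) = (g (?y t) - g x) / t)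
      (at_right 0)"
    using eventually_at_right_less[of "0::real"]
  proof eventually_elim
    case (elim t)
    obtain i where i: "i \<in> I" "g (?y t) = f i (?y t)"
      using ray[of t] Min_image_in[OF I, of "\<lambda>i. f i (?y t)"] elim by auto
    have le: "g (?y t) \<le> f k (?y t)" if "k \<in> I" for k
      using ray[of t] elim that I by simp
    have "f i (?y t) \<le> f j (?y t)"
      using le[of j] i j J by auto
    \<comment> \<open>A minimizer at parameter \<open>t\<close> is active at \<open>x\<close>:
      otherwise \<open>f j\<close> would lie strictly below it.\<close>
    then have iJ: "i \<in> J"
      using elim(1) i(1) by (meson DiffI linorder_not_le)
    show ?case
    proof (rule Min_eqI)
      show "finite ((\<lambda>i. (f i (?y t) - f i x) / t) ` J)" using J by simp
      show "(g (?y t) - g x) / t \<in> (\<lambda>i. (f i (?y t) - f i x) / t) ` J"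
        using iJ i by (auto simp: J_def intro!: image_eqI[of _ _ i])
      fix z assume "z \<in> (\<lambda>i. (f i (?y t) - f i x) / t) ` J"
      then show "(g (?y t) - g x) / t \<le> z"
        using le elim by (auto simp: J_def intro!: divide_right_mono)
    qed
  qed
  moreover have "((\<lambda>t. MIN i\<in>J. (f i (?y t) - f i x) / t) \<longlongrightarrow> (MIN i\<in>J. d i)) (at_right 0)"
    using J d unfolding has_dir_deriv_def by (intro tendsto_Min) auto
  ultimately have "((\<lambda>t. (g (?y t) - g x) / t) \<longlongrightarrow> (MIN i\<in>J. d i)) (at_right 0)"
    by (rule Lim_transform_eventually[rotated])
  then show ?thesis unfolding has_dir_deriv_def J_def .
qed

text \<open>Lets finitely many functions with different bounds be treated with one common bound, the
  same at all levels of the recursion.\<close>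

lemma M_directed_subdifferentiable_mono:
  "M_directed_subdifferentiable Pr M (Suc n) f x \<Longrightarrow> M \<le> M' \<Longrightarrow>
    M_directed_subdifferentiable Pr M' (Suc n) f x"
proof (induction n arbitrary: f x)
  case (Suc n)
  then show ?case by simp (meson order_trans)
qed auto

lemma mem_Rn: "x \<in> Rn n \<longleftrightarrow> (\<forall>i\<ge>n. x i = 0)"
  by (simp add: topspace_Euclidean_space)

lemma line_vec_in_Rn: "line_vec s \<in> Rn (Suc n)"
  by (simp add: mem_Rn line_vec_def)

lemma transpose_map_in_Rn: "transpose_map n P y \<in> Rn n"
  by (simp add: mem_Rn transpose_map_def)

text \<open>The transpose sends 0 to 0. The values of the slices at the origin are thus the
  directional derivatives whose minimum determines \<open>J(l)\<close>.\<close>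

lemma slice_zero: "slice Pr n f x l (\<lambda>i. 0) = dir_deriv f x l"
  by (simp add: slice_def transpose_map_def cong: if_cong)

lemma unit_sphere_subset_Rn: "unit_sphere (Suc n) \<subseteq> Rn (Suc n)"
  by (auto simp: mem_Rn nsphere)

lemma abs_Min_le:
  fixes h :: "'i \<Rightarrow> real"
  assumes "finite I" "I \<noteq> {}" "\<And>i. i \<in> I \<Longrightarrow> \<bar>h i\<bar> \<le> M"
  shows "\<bar>MIN i\<in>I. h i\<bar> \<le> M"
  using Min_image_in[OF assms(1,2), of h] assms(3) by force

text \<open>Needed in dimension 1, where lower end points carry a minus sign: their maximum in
  \<open>directed_Inf\<close> becomes a minimum of derivatives in direction -1.\<close>

lemma Max_uminus:
  fixes h :: "'i \<Rightarrow> real"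
  assumes "finite I" "I \<noteq> {}"
  shows "(MAX i\<in>I. - h i) = - (MIN i\<in>I. h i)"
  using minus_Min_eq_Max[of "h ` I"] assms by (simp add: image_image)

text \<open>The ray from \<open>x\<close> in direction \<open>l\<close> stays in
  \<open>Rn n\<close>, where \<open>g\<close> is known to be the minimum.\<close>

lemma has_dir_deriv_Min_Rn:
  assumes "finite I" "I \<noteq> {}" "x \<in> Rn n" "l \<in> Rn n"
    and "\<And>y. y \<in> Rn n \<Longrightarrow> g y = (MIN i\<in>I. f i y)"
    and "\<And>i. i \<in> I \<Longrightarrow> dir_differentiable (f i) x l"
  shows "has_dir_deriv g x l (MIN i\<in>{i \<in> I. g x = f i x}. dir_deriv (f i) x l)"
  using assms by (intro has_dir_deriv_Min) (auto simp: mem_Rn dir_differentiable_iff)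

text \<open>Induction on the dimension. The index set, functions and base point all vary, since the
  step passes to the active indices, the slices and the origin; \<open>M\<close> stays
  fixed.\<close>

lemma M_directed_subdifferentiable_Min:
  assumes "finite I" "I \<noteq> {}" "x \<in> Rn (Suc n)"
    and "\<And>i. i \<in> I \<Longrightarrow> M_directed_subdifferentiable Pr M (Suc n) (f i) x"
    and "\<And>y. y \<in> Rn (Suc n) \<Longrightarrow> g y = (MIN i\<in>I. f i y)"
  shows "M_directed_subdifferentiable Pr M (Suc n) g x \<and>
         directed_subdifferential Pr (Suc n) g x =
           directed_Inf (Suc n) {i \<in> I. g x = f i x} (\<lambda>i. directed_subdifferential Pr (Suc n) (f i) x)"
  using assms
proof (induction n arbitrary: I f g x)
  case 0
  let ?J = "{i \<in> I. g x = f i x}"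
  have J: "finite ?J" "?J \<noteq> {}"
    using 0 active_nonempty[of I g x f] by auto
  have h: "has_dir_deriv g x (line_vec s) (MIN i\<in>?J. dir_deriv (f i) x (line_vec s))"
    if "s \<in> {1, -1}" for s
    using 0 that by (intro has_dir_deriv_Min_Rn[where n = 1]) (auto simp: line_vec_in_Rn)
  note d = h[THEN has_dir_derivD]
  have "\<bar>dir_deriv g x (line_vec s)\<bar> \<le> M" if "s \<in> {1, -1}" for s
    unfolding d[OF that] by (rule abs_Min_le[OF J]) (use 0(4) that in auto)
  then have "M_directed_subdifferentiable Pr M (Suc 0) g x"
    using h by (auto simp: dir_differentiable_def)
  then show ?case
    using d by (simp add: Max_uminus[OF J])
next
  case (Suc n)
  let ?N = "Suc (Suc n)"
  let ?J = "{i \<in> I. g x = f i x}"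
  let ?D = "\<lambda>l. MIN i\<in>?J. dir_deriv (f i) x l"
  have J: "finite ?J" "?J \<noteq> {}"
    using Suc.prems active_nonempty[of I g x f] by auto
  have h: "has_dir_deriv g x l (?D l)" if "l \<in> Rn ?N" for l
    using Suc.prems that by (intro has_dir_deriv_Min_Rn[where n = ?N]) auto
  note d = h[THEN has_dir_derivD]
  have sub: "l \<in> Rn ?N" if "l \<in> unit_sphere ?N" for l
    using that unit_sphere_subset_Rn by blast
  \<comment> \<open>The set \<open>?J\<close> depends on \<open>x\<close> but not on the direction,
    so this is a minimum of a fixed finite family of continuous functions.\<close>
  have "continuous_map (Euclidean_space ?N) euclideanreal ?D"
    using Suc.prems J by (intro continuous_map_Min) auto
  then have cont: "continuous_map (Euclidean_space ?N) euclideanreal (dir_deriv g x)"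
    by (rule continuous_map_eq) (simp add: d)
  have bd: "\<bar>dir_deriv g x l\<bar> \<le> M" if "l \<in> unit_sphere ?N" for l
    unfolding d[OF sub[OF that]] by (rule abs_Min_le[OF J]) (use Suc.prems(4) that in auto)
  \<comment> \<open>The direction \<open>l\<close> plus the transposed image of \<open>y\<close> is
    again a vector of \<open>Rn ?N\<close>, so the formula for the derivative of \<open>g\<close>
    applies to it, for every \<open>y\<close>.\<close>
  have sl: "slice Pr ?N g x l y = (MIN i\<in>?J. slice Pr ?N (f i) x l y)"
    if "l \<in> unit_sphere ?N" for l y
    unfolding slice_def using sub[OF that] transpose_map_in_Rn[of ?N "Pr ?N l" y]
    by (intro d) (auto simp: mem_Rn)
  have IH: "M_directed_subdifferentiable Pr M (Suc n) (slice Pr ?N g x l) (\<lambda>i. 0) \<and>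
      directed_subdifferential Pr (Suc n) (slice Pr ?N g x l) (\<lambda>i. 0) =
      directed_Inf (Suc n) {i \<in> ?J. dir_deriv (f i) x l = ?D l}
        (\<lambda>i. directed_subdifferential Pr (Suc n) (slice Pr ?N (f i) x l) (\<lambda>i. 0))"
    if l: "l \<in> unit_sphere ?N" for l
  proof -
    \<comment> \<open>At the origin the slice of \<open>g\<close> has the value \<open>?D l\<close>,
      so the indices active there form the set \<open>J(l)\<close> of the infimum over
      \<open>?J\<close>.\<close>
    have "{i \<in> ?J. dir_deriv (f i) x l = ?D l} =
        {i \<in> ?J. slice Pr ?N g x l (\<lambda>i. 0) = slice Pr ?N (f i) x l (\<lambda>i. 0)}"
      unfolding slice_zero d[OF sub[OF l]] by auto
    moreover have "M_directed_subdifferentiable Pr M (Suc n) (slice Pr ?N (f i) x l) (\<lambda>i. 0)"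
      if "i \<in> ?J" for i
      using Suc.prems(4)[of i] that l by simp
    ultimately show ?thesis
      using Suc.IH[OF J, where x = "\<lambda>i. 0" and f = "\<lambda>i. slice Pr ?N (f i) x l"] sl[OF l]
      by (simp only:) (simp add: mem_Rn)
  qed
  have "M_directed_subdifferentiable Pr M ?N g x"
    using h cont bd IH by (auto simp: dir_differentiable_def)
  \<comment> \<open>Both families are restricted to the sphere, so it suffices to compare them for
    \<open>l\<close> on it: \<open>IH\<close> gives the parts and \<open>d\<close> the real
    components.\<close>
  moreover have "directed_subdifferential Pr ?N g x =
      directed_Inf ?N ?J (\<lambda>i. directed_subdifferential Pr ?N (f i) x)"
    using IH d sub by (auto intro!: restrict_ext)
  ultimately show ?case by blast
qed

theorem proposition2p11:
  fixes n p :: nat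
    and Pr :: "nat \<Rightarrow> vec \<Rightarrow> vec \<Rightarrow> vec"
    and fs :: "nat \<Rightarrow> vec \<Rightarrow> real"
    and f :: "vec \<Rightarrow> real"
    and x :: vec
  assumes "n \<ge> 1" and "p \<ge> 1"
    and "\<And>m l. m \<ge> 2 \<Longrightarrow> l \<in> unit_sphere m \<Longrightarrow> is_projection m l (Pr m l)"
    and "x \<in> Rn n"
    and "\<And>i. i \<in> {1..p} \<Longrightarrow> directed_subdifferentiable Pr n (fs i) x"
    and "\<And>y. y \<in> Rn n \<Longrightarrow> f y = (MIN i\<in>{1..p}. fs i y)"
  shows "directed_subdifferentiable Pr n f x \<and>
         directed_subdifferential Pr n f x =
           directed_Inf n {i \<in> {1..p}. f x = fs i x} (\<lambda>i. directed_subdifferential Pr n (fs i) x)"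

proof -
  obtain M where M: "\<And>i. i \<in> {1..p} \<Longrightarrow> M i \<ge> 0 \<and> M_directed_subdifferentiable Pr (M i) n (fs i) x"
    using assms(5) unfolding directed_subdifferentiable_def by metis
  \<comment> \<open>As all \<open>M i\<close> are nonnegative, their sum is nonnegative and
    dominates each of them.\<close>
  define K where "K = (\<Sum>i\<in>{1..p}. M i)"
  have K: "K \<ge> 0" "\<And>i. i \<in> {1..p} \<Longrightarrow> M i \<le> K"
    unfolding K_def using M by (auto intro!: sum_nonneg member_le_sum)
  obtain k where n: "n = Suc k" using assms(1) by (cases n) auto
  have "M_directed_subdifferentiable Pr K n (fs i) x" if "i \<in> {1..p}" for i
    using M[OF that] K(2)[OF that] M_directed_subdifferentiable_mono unfolding n by blast
  then have "M_directed_subdifferentiable Pr K n f x \<and>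
      directed_subdifferential Pr n f x =
        directed_Inf n {i \<in> {1..p}. f x = fs i x} (\<lambda>i. directed_subdifferential Pr n (fs i) x)"
    using M_directed_subdifferentiable_Min[of "{1..p}" x k Pr K fs f] assms n by simp
  then show ?thesis
    using K(1) unfolding directed_subdifferentiable_def by blast
qed

end
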